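(* Measure the size of a perfect hexahedron, with associated solution $(a,b,c,d,e,f)$ in positive integers of $$a^2+b^2=c^2,\qquad d^2=e^2+ab,\qquad f^2=d^2+ab,$$ by the number $\frac{ab}{2}$. (1) There is a unique perfect hexahedron with solution of size $60$ (the solution being unique up to interchanging $a$ and $b$), and it is the smallest; it has $a=8,\ b=15,\ c=17,\ d=13,\ e=7,\ f=17$. (2) The second smallest is a perfect hexahedron with solution of size $120$; it has $a=24,\ b=10,\ c=26,\ d=17,\ e=7,\ f=23$.
   Context: A perfect hexahedron here is a six-sided polyhedron in $\mathbf{R}^3$ built as follows. Take two congruent rectangles with sides $a,b$ and diagonal $c$, placed in parallel planes so that the line through their centers is perpendicular to both planes, the bottom rectangle being rotated by ninety degrees from the position of the top one. Connect the sides of the two rectangles by four congruent trapezoids with parallel sides $a,b$, slant side $e$ and diagonal $d$. Let $f$ be the interior diagonal of the solid. All of $a,b,c,d,e,f$ are required to be positive integers. These lengths satisfy $a^2+b^2=c^2$, $d^2=e^2+ab$, $f^2=d^2+ab$, and the paper asserts that the positive integer solutions of these three equations give the edge and diagonal lengths of perfect hexahedra; $(a,b,c,d,e,f)$ is the solution associated with the hexahedron.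
   Formalization: Part (2) is stated for positive integer solutions only, not for solids: no perfect hexahedron has a=24, b=10, e=7, since the squared height would be 49-98<0; "second smallest" is taken among solutions. Part (1) covers solutions and solids. *)

theory Defs
  imports "HOL-Analysis.Analysis"
begin

definition hexahedron_solution :: "nat \<Rightarrow> nat \<Rightarrow> nat \<Rightarrow> nat \<Rightarrow> nat \<Rightarrow> nat \<Rightarrow> bool" where
  "hexahedron_solution a b c d e f \<longleftrightarrow>
     a > 0 \<and> b > 0 \<and> c > 0 \<and> d > 0 \<and> e > 0 \<and> f > 0 \<and>
     a\<^sup>2 + b\<^sup>2 = c\<^sup>2 \<and> d\<^sup>2 = e\<^sup>2 + a * b \<and> f\<^sup>2 = d\<^sup>2 + a * b"

definition hexahedron_size :: "nat \<Rightarrow> nat \<Rightarrow> real" where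
  "hexahedron_size a b = real (a * b) / 2"

text \<open>
  Standard position: the bottom rectangle lies in the plane \<open>z = 0\<close> and the top one in the plane
  \<open>z = h\<close>, both centred on the \<open>z\<close>-axis. The sides of the top rectangle along the \<open>x\<close>- and
  \<open>y\<close>-directions are \<open>a\<close> and \<open>b\<close>; those of the bottom one are \<open>b\<close> and \<open>a\<close>. The signs \<open>s\<close>, \<open>t\<close>
  range over \<open>-1\<close> and \<open>1\<close>.
\<close>

definition top_vertex :: "real \<Rightarrow> real \<Rightarrow> real \<Rightarrow> real \<Rightarrow> real \<Rightarrow> real ^ 3" where
  "top_vertex a b h s t = vector [s * a / 2, t * b / 2, h]"

definition bottom_vertex :: "real \<Rightarrow> real \<Rightarrow> real \<Rightarrow> real \<Rightarrow> real ^ 3" where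
  "bottom_vertex a b s t = vector [s * b / 2, t * a / 2, 0]"

definition standard_hexahedron :: "real \<Rightarrow> real \<Rightarrow> real \<Rightarrow> (real ^ 3) set" where
  "standard_hexahedron a b h =
     convex hull ({top_vertex a b h s t | s t. s \<in> {-1, 1} \<and> t \<in> {-1, 1}} \<union>
                  {bottom_vertex a b s t | s t. s \<in> {-1, 1} \<and> t \<in> {-1, 1}})"

definition congruent_solids :: "(real ^ 3) set \<Rightarrow> (real ^ 3) set \<Rightarrow> bool" where
  "congruent_solids G H \<longleftrightarrow>
     (\<exists>p T. orthogonal_transformation T \<and> H = (\<lambda>x. p + T x) ` G)"

text \<open>
  The distances below are, in order: the diagonals of the two rectangles, the slant edges, the two
  families of diagonals of the lateral trapezoids, and the interior diagonals.
\<close>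

definition perfect_hexahedron ::
    "(real ^ 3) set \<Rightarrow> nat \<Rightarrow> nat \<Rightarrow> nat \<Rightarrow> nat \<Rightarrow> nat \<Rightarrow> nat \<Rightarrow> bool" where
  "perfect_hexahedron H a b c d e f \<longleftrightarrow>
     a > 0 \<and> b > 0 \<and> c > 0 \<and> d > 0 \<and> e > 0 \<and> f > 0 \<and>
     (\<exists>h>0. congruent_solids (standard_hexahedron a b h) H \<and>
       (\<forall>s\<in>{-1, 1}. \<forall>t\<in>{-1, 1}.
          dist (top_vertex a b h s t) (top_vertex a b h (-s) (-t)) = c \<and>
          dist (bottom_vertex a b s t) (bottom_vertex a b (-s) (-t)) = c \<and>
          dist (top_vertex a b h s t) (bottom_vertex a b s t) = e \<and>
          dist (top_vertex a b h s t) (bottom_vertex a b (-s) t) = d \<and>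
          dist (top_vertex a b h s t) (bottom_vertex a b s (-t)) = d \<and>
          dist (top_vertex a b h s t) (bottom_vertex a b (-s) (-t)) = f))"

lemma dist_vector3_sq:
  "(dist (vector [x, y, z] :: real ^ 3) (vector [x', y', z']))\<^sup>2 =
     (x - x')\<^sup>2 + (y - y')\<^sup>2 + (z - z')\<^sup>2"
  unfolding dist_norm power2_norm_eq_inner by (simp add: inner_vec_def sum_3 power2_eq_square)

lemma perfect_hexahedron_dist:
  assumes "perfect_hexahedron H a b c d e f"
  obtains h :: real where "h > 0"
    "(real a)\<^sup>2 + (real b)\<^sup>2 = (real c)\<^sup>2"
    "(real e)\<^sup>2 = (real a - real b)\<^sup>2 / 2 + h\<^sup>2"
    "(real d)\<^sup>2 = ((real a)\<^sup>2 + (real b)\<^sup>2) / 2 + h\<^sup>2"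
    "(real f)\<^sup>2 = (real a + real b)\<^sup>2 / 2 + h\<^sup>2"
proof -
  obtain h :: real where h: "h > 0"
    and D: "dist (top_vertex a b h 1 1) (top_vertex a b h (-1) (-1)) = c"
      "dist (top_vertex a b h 1 1) (bottom_vertex a b 1 1) = e"
      "dist (top_vertex a b h 1 1) (bottom_vertex a b (-1) 1) = d"
      "dist (top_vertex a b h 1 1) (bottom_vertex a b (-1) (-1)) = f"
    using assms unfolding perfect_hexahedron_def by auto
  note V = top_vertex_def bottom_vertex_def dist_vector3_sq
  show thesis
  proof (rule that[OF h])
    show "(real a)\<^sup>2 + (real b)\<^sup>2 = (real c)\<^sup>2"
      unfolding D(1)[symmetric] V by simp
    show "(real e)\<^sup>2 = (real a - real b)\<^sup>2 / 2 + h\<^sup>2"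
      unfolding D(2)[symmetric] V by (simp add: power2_eq_square field_simps)
    show "(real d)\<^sup>2 = ((real a)\<^sup>2 + (real b)\<^sup>2) / 2 + h\<^sup>2"
      unfolding D(3)[symmetric] V by (simp add: power2_eq_square field_simps)
    show "(real f)\<^sup>2 = (real a + real b)\<^sup>2 / 2 + h\<^sup>2"
      unfolding D(4)[symmetric] V by (simp add: power2_eq_square field_simps)
  qed
qed

lemma perfect_hexahedron_imp_solution:
  assumes "perfect_hexahedron H a b c d e f"
  shows "hexahedron_solution a b c d e f"
proof -
  obtain h :: real where
    E: "(real a)\<^sup>2 + (real b)\<^sup>2 = (real c)\<^sup>2"
    "(real e)\<^sup>2 = (real a - real b)\<^sup>2 / 2 + h\<^sup>2"
    "(real d)\<^sup>2 = ((real a)\<^sup>2 + (real b)\<^sup>2) / 2 + h\<^sup>2"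
    "(real f)\<^sup>2 = (real a + real b)\<^sup>2 / 2 + h\<^sup>2"
    using perfect_hexahedron_dist[OF assms] by metis
  have "real (a\<^sup>2 + b\<^sup>2) = real (c\<^sup>2)" using E(1) by simp
  moreover have "real (d\<^sup>2) = real (e\<^sup>2 + a * b)" "real (f\<^sup>2) = real (d\<^sup>2 + a * b)"
    using E(2-4) by (simp_all add: power2_eq_square field_simps)
  ultimately have "a\<^sup>2 + b\<^sup>2 = c\<^sup>2" "d\<^sup>2 = e\<^sup>2 + a * b" "f\<^sup>2 = d\<^sup>2 + a * b"
    by (simp_all only: of_nat_eq_iff)
  with assms show ?thesis
    unfolding perfect_hexahedron_def hexahedron_solution_def by blast
qed

text \<open>
  The converse fails: a solution comes from a solid exactly when the height is real, that is when
  \<open>2 * e\<^sup>2 > (a - b)\<^sup>2\<close>. This excludes the solution of size 120 (its lateral trapezoids would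
  have height 0), which is therefore only meaningful as a solution of the equations.
\<close>

lemma hexahedron_solution_24_10: "hexahedron_solution 24 10 26 17 7 23"
  by (simp add: hexahedron_solution_def)

lemma not_perfect_hexahedron_24_10: "\<not> perfect_hexahedron H 24 10 26 17 7 23"
proof
  assume "perfect_hexahedron H 24 10 26 17 7 23"
  then obtain h :: real where "h > 0" "(real 7)\<^sup>2 = (real 24 - real 10)\<^sup>2 / 2 + h\<^sup>2"
    using perfect_hexahedron_dist by metis
  then have "h\<^sup>2 = -49" by simp
  then show False by (metis neg_0_le_iff_le not_numeral_le_zero zero_le_power2)
qed

end

theory Submission
  imports Defs
begin

text \<open>
  A solution consists of a Pythagorean pair of legs \<open>a\<close>, \<open>b\<close> whose product is the common
  difference of an arithmetic progression \<open>e\<^sup>2, d\<^sup>2, f\<^sup>2\<close> of three squares. The two conditions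
  leave very few candidates when \<open>a * b \<le> 240\<close>.

  Only eight pairs of legs \<open>a \<le> b\<close> have product at most 240, and all their products are of the
  form \<open>4 * N\<close> (\<open>pythagorean_legs_product_le_240\<close>). Since the difference is even, \<open>e\<close>, \<open>d\<close>, \<open>f\<close>
  have the same parity, so the difference of squares factors as \<open>4 * N = (d - e) * (d + e)\<close> with
  even factors: \<open>d\<close> is the sum of two factors with product \<open>N\<close>, and by the same argument for
  \<open>f\<^sup>2 - d\<^sup>2\<close> it is also the difference of two factors with product \<open>N\<close>. Comparing
  the lists of sums and differences for each \<open>N\<close> leaves only \<open>13 = 3 + 10 = 15 - 2\<close> for \<open>N = 30\<close> and
  \<open>17 = 5 + 12 = 20 - 3\<close> for \<open>N = 60\<close> (\<open>square_progression_small_difference\<close>), which give the two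
  solutions of sizes 60 and 120.

  For the solids, the height is determined by \<open>e\<^sup>2 = (a - b)\<^sup>2 / 2 + h\<^sup>2\<close>, and interchanging \<open>a\<close>
  with \<open>b\<close> gives the mirror image in the plane \<open>x = y\<close>. Hence the solid of size 60 is unique up to
  congruence; it exists because \<open>2 * 7\<^sup>2 - (8 - 15)\<^sup>2 = 49\<close> is positive.
\<close>

section \<open>Solutions of small size\<close>

lemma hexahedron_solution_swap:
  "hexahedron_solution a b c d e f \<Longrightarrow> hexahedron_solution b a c d e f"
  by (simp add: hexahedron_solution_def mult.commute add.commute)

text \<open>
  With \<open>c = b + k\<close> the equation becomes \<open>a\<^sup>2 = k * (2 * b + k)\<close>. As \<open>a\<^sup>2 \<le> a * b \<le> 240\<close> bounds
  \<open>a\<close> by 15, and \<open>b \<ge> a\<close> then bounds \<open>k\<close> by 6, there are finitely many pairs \<open>a\<close>, \<open>k\<close>, and each of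
  them determines \<open>b\<close>.
\<close>

lemma pythagorean_legs_product_le_240:
  fixes a b c :: nat
  assumes pyth: "a\<^sup>2 + b\<^sup>2 = c\<^sup>2" and "0 < a" "a \<le> b" and prod: "a * b \<le> 240"
  shows "(a, b, c) \<in> {(3, 4, 5), (6, 8, 10), (5, 12, 13), (9, 12, 15), (8, 15, 17), (7, 24, 25),
    (12, 16, 20), (10, 24, 26)}"
proof -
  have "b\<^sup>2 < c\<^sup>2" using pyth \<open>0 < a\<close> by (metis less_add_same_cancel2 zero_less_power)
  then have "b < c" using power2_less_imp_less by blast
  then obtain k where k: "c = b + k" "0 < k" using less_imp_add_positive by blast
  have a2: "a * a = k * (2 * b + k)"
    using pyth by (simp add: k(1) power2_eq_square algebra_simps)
  have "a \<le> 15"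
  proof (rule ccontr)
    assume "\<not> a \<le> 15"
    then have "16 * 16 \<le> a * b" using \<open>a \<le> b\<close> by (intro mult_le_mono) auto
    then show False using prod by simp
  qed
  \<comment> \<open>Otherwise \<open>14 * a + 49 \<le> a\<^sup>2 \<le> 15 * a\<close>, which needs \<open>a \<ge> 49\<close>.\<close>
  have "k \<le> 6"
  proof (rule ccontr)
    assume "\<not> k \<le> 6"
    then have "7 * (2 * a + 7) \<le> k * (2 * b + k)"
      using \<open>a \<le> b\<close> by (intro mult_le_mono) auto
    moreover have "a * a \<le> 15 * a" using \<open>a \<le> 15\<close> by (rule mult_le_mono1)
    ultimately show False using a2 \<open>a \<le> 15\<close> by simp
  qed
  have b: "b = (a * a - k * k) div (2 * k)"
  proof -
    have "a * a - k * k = (2 * k) * b" using a2 by (simp add: distrib_left)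
    then show ?thesis using \<open>0 < k\<close> by simp
  qed
  have a_range: "a \<in> {1, 2, 3, 4, 5, 6, 7, 8, 9, 10, 11, 12, 13, 14, 15}"
    using \<open>0 < a\<close> \<open>a \<le> 15\<close> by (simp; presburger)
  have k_range: "k \<in> {1, 2, 3, 4, 5, 6}"
    using \<open>0 < k\<close> \<open>k \<le> 6\<close> by (simp; presburger)
  have "\<forall>a\<in>{1, 2, 3, 4, 5, 6, 7, 8, 9, 10, 11, 12, 13, 14, 15::nat}. \<forall>k\<in>{1, 2, 3, 4, 5, 6}.
      let b = (a * a - k * k) div (2 * k) in
      a * a = k * (2 * b + k) \<and> a \<le> b \<and> a * b \<le> 240 \<longrightarrow>
      (a, b, b + k) \<in> {(3, 4, 5), (6, 8, 10), (5, 12, 13), (9, 12, 15), (8, 15, 17), (7, 24, 25),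
        (12, 16, 20), (10, 24, 26)}"
    by code_simp
  note cases = bspec[OF bspec[OF this a_range] k_range, unfolded Let_def, folded b]
  show ?thesis unfolding k(1) by (rule mp[OF cases]) (intro conjI a2 \<open>a \<le> b\<close> prod)
qed

lemma even_difference_of_squares:
  fixes d e n :: nat
  assumes "d\<^sup>2 = e\<^sup>2 + n" "even n"
  obtains k where "d = e + 2 * k" "n = 4 * (k * (e + k))"
proof -
  have "e\<^sup>2 \<le> d\<^sup>2" unfolding assms(1) by (rule le_add1)
  then have "e \<le> d" by (simp only: power2_nat_le_eq_le)
  have "even (d\<^sup>2) \<longleftrightarrow> even (e\<^sup>2)" unfolding assms(1) using \<open>even n\<close> by simp
  then have "even (d - e)" using \<open>e \<le> d\<close> by simp
  then obtain k where "d - e = 2 * k" by (rule evenE)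
  with \<open>e \<le> d\<close> have k: "d = e + 2 * k" by simp
  with assms(1) have "n = 4 * (k * (e + k))"
    by (simp add: power2_eq_square algebra_simps)
  with k that show thesis by blast
qed

text \<open>
  The factor pairs \<open>k \<le> m\<close> of the eight values of \<open>N\<close>, written as \<open>m = y + k\<close>. The smaller factor
  is at most 7, because its square is at most \<open>N\<close>.
\<close>

lemma factor_pairs:
  fixes N k y :: nat
  assumes N: "N \<in> {3, 12, 15, 27, 30, 42, 48, 60}" and factor: "N = k * (y + k)"
  shows "(N, k, y) \<in>
      {(3, 1, 2), (12, 1, 11), (12, 2, 4), (12, 3, 1), (15, 1, 14), (15, 3, 2), (27, 1, 26),
      (27, 3, 6), (30, 1, 29), (30, 2, 13), (30, 3, 7), (30, 5, 1), (42, 1, 41), (42, 2, 19),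
      (42, 3, 11), (42, 6, 1), (48, 1, 47), (48, 2, 22), (48, 3, 13), (48, 4, 8), (48, 6, 2),
      (60, 1, 59), (60, 2, 28), (60, 3, 17), (60, 4, 11), (60, 5, 7), (60, 6, 4)}"
proof -
  have "k * k \<le> N" by (simp add: factor)
  have "k \<le> 7"
  proof (rule ccontr)
    assume "\<not> k \<le> 7"
    then have "8 * 8 \<le> k * k" by (intro mult_le_mono) auto
    then show False using \<open>k * k \<le> N\<close> N by auto
  qed
  moreover have "k \<noteq> 0" using factor N by (intro notI) simp
  ultimately have k: "k \<in> {1, 2, 3, 4, 5, 6, 7}" by (simp; presburger)
  have y: "y = N div k - k"
    using \<open>k \<noteq> 0\<close> by (subst factor) simp
  have "\<forall>N\<in>{3, 12, 15, 27, 30, 42, 48, 60::nat}. \<forall>k\<in>{1, 2, 3, 4, 5, 6, 7}.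
      let y = N div k - k in N = k * (y + k) \<longrightarrow>
      (N, k, y) \<in>
      {(3, 1, 2), (12, 1, 11), (12, 2, 4), (12, 3, 1), (15, 1, 14), (15, 3, 2), (27, 1, 26),
      (27, 3, 6), (30, 1, 29), (30, 2, 13), (30, 3, 7), (30, 5, 1), (42, 1, 41), (42, 2, 19),
      (42, 3, 11), (42, 6, 1), (48, 1, 47), (48, 2, 22), (48, 3, 13), (48, 4, 8), (48, 6, 2),
      (60, 1, 59), (60, 2, 28), (60, 3, 17), (60, 4, 11), (60, 5, 7), (60, 6, 4)}"
    by code_simp
  note cases = bspec[OF bspec[OF this N] k, unfolded Let_def, folded y]
  show ?thesis by (rule mp[OF cases factor])
qed

text \<open>
  The factorizations are \<open>N = k * (e + k) = l * (d + l)\<close>, so that \<open>d = k + (e + k)\<close> is a sum and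
  \<open>d = (d + l) - l\<close> a difference of complementary factors.
\<close>

lemma square_progression_small_difference:
  fixes d e f N :: nat
  assumes ed: "d\<^sup>2 = e\<^sup>2 + 4 * N" and df: "f\<^sup>2 = d\<^sup>2 + 4 * N"
    and N: "N \<in> {3, 12, 15, 27, 30, 42, 48, 60}"
  shows "(N, d, e, f) \<in> {(30, 13, 7, 17), (60, 17, 7, 23)}"
proof -
  obtain k where k: "d = e + 2 * k" "N = k * (e + k)"
    using even_difference_of_squares[OF ed] by auto
  obtain l where l: "N = l * (d + l)"
    using even_difference_of_squares[OF df] by auto
  have sum: "(N, d) \<in>
      {(3, 4), (12, 13), (12, 8), (12, 7), (15, 16), (15, 8), (27, 28), (27, 12), (30, 31),
        (30, 17), (30, 13), (30, 11), (42, 43), (42, 23), (42, 17), (42, 13), (48, 49),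
        (48, 26), (48, 19), (48, 16), (48, 14), (60, 61), (60, 32), (60, 23), (60, 19),
        (60, 17), (60, 16)}"
    using factor_pairs[OF N k(2)] unfolding k(1) by (elim insertE emptyE) simp_all
  have difference: "(N, d) \<in>
      {(3, 2), (12, 11), (12, 4), (12, 1), (15, 14), (15, 2), (27, 26), (27, 6), (30, 29),
        (30, 13), (30, 7), (30, 1), (42, 41), (42, 19), (42, 11), (42, 1), (48, 47), (48, 22),
        (48, 13), (48, 8), (48, 2), (60, 59), (60, 28), (60, 17), (60, 11), (60, 7), (60, 4)}"
    using factor_pairs[OF N l] by (elim insertE emptyE) simp_all
  have "(N, d) \<in> {(30, 13), (60, 17)}"
    using IntI[OF sum difference] by simp
  then consider "N = 30" "d = 13" | "N = 60" "d = 17" by auto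
  then show ?thesis
  proof cases
    case 1
    with ed df have "e\<^sup>2 = 7\<^sup>2" "f\<^sup>2 = 17\<^sup>2" by simp_all
    with 1 show ?thesis by (simp only: power2_eq_iff_nonneg zero_le) simp
  next
    case 2
    with ed df have "e\<^sup>2 = 7\<^sup>2" "f\<^sup>2 = 23\<^sup>2" by simp_all
    with 2 show ?thesis by (simp only: power2_eq_iff_nonneg zero_le) simp
  qed
qed

lemma hexahedron_solution_ordered_le_240:
  assumes sol: "hexahedron_solution a b c d e f" and "a \<le> b" "a * b \<le> 240"
  shows "(a, b, c, d, e, f) \<in> {(8, 15, 17, 13, 7, 17), (10, 24, 26, 17, 7, 23)}"
proof -
  have E: "0 < a" "a\<^sup>2 + b\<^sup>2 = c\<^sup>2" "d\<^sup>2 = e\<^sup>2 + a * b" "f\<^sup>2 = d\<^sup>2 + a * b"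
    using sol by (auto simp: hexahedron_solution_def)
  note abc = pythagorean_legs_product_le_240[OF E(2,1) assms(2,3)]
  obtain N where N: "a * b = 4 * N" "N \<in> {3, 12, 15, 27, 30, 42, 48, 60}"
  proof
    show "a * b = 4 * (a * b div 4)" "a * b div 4 \<in> {3, 12, 15, 27, 30, 42, 48, 60}"
      using abc by auto
  qed
  have "(N, d, e, f) \<in> {(30, 13, 7, 17), (60, 17, 7, 23)}"
    using square_progression_small_difference[OF _ _ N(2)] E(3,4) N(1) by simp
  with abc show ?thesis
    using N(1) by (elim insertE emptyE) simp_all
qed

lemma hexahedron_solution_le_240:
  assumes "hexahedron_solution a b c d e f" "a * b \<le> 240"
  shows "(a, b, c, d, e, f) \<in> {(8, 15, 17, 13, 7, 17), (15, 8, 17, 13, 7, 17),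
    (10, 24, 26, 17, 7, 23), (24, 10, 26, 17, 7, 23)}"
proof (cases "a \<le> b")
  case True
  then show ?thesis using hexahedron_solution_ordered_le_240[OF assms(1)] assms(2) by auto
next
  case False
  then show ?thesis
    using hexahedron_solution_ordered_le_240[OF hexahedron_solution_swap[OF assms(1)]] assms(2)
    by (auto simp: mult.commute)
qed

section \<open>Congruence and existence of the solids\<close>

lemma congruent_solids_sym:
  assumes "congruent_solids G H"
  shows "congruent_solids H G"
proof -
  obtain p T where T: "orthogonal_transformation T" and H: "H = (\<lambda>x. p + T x) ` G"
    using assms unfolding congruent_solids_def by blast
  have invT: "inv T (T x) = x" for x
    using T by (simp add: orthogonal_transformation_inj)
  have T': "orthogonal_transformation (inv T)"
    using T by (rule orthogonal_transformation_inv)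
  have "- inv T p + inv T (p + T x) = x" for x
    using linear_add[OF orthogonal_transformation_linear[OF T']] by (simp add: invT)
  then have "G = (\<lambda>x. - inv T p + inv T x) ` H"
    by (simp add: H image_image)
  with T' show ?thesis unfolding congruent_solids_def by blast
qed

lemma congruent_solids_trans:
  assumes "congruent_solids F G" "congruent_solids G H"
  shows "congruent_solids F H"
proof -
  obtain p S where S: "orthogonal_transformation S" and G: "G = (\<lambda>x. p + S x) ` F"
    using assms(1) unfolding congruent_solids_def by blast
  obtain q T where T: "orthogonal_transformation T" and H: "H = (\<lambda>x. q + T x) ` G"
    using assms(2) unfolding congruent_solids_def by blast
  have "H = (\<lambda>x. (q + T p) + (T \<circ> S) x) ` F"
    by (simp add: G H image_image linear_add[OF orthogonal_transformation_linear[OF T]] add.assoc)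
  with orthogonal_transformation_compose[OF T S] show ?thesis
    unfolding congruent_solids_def by blast
qed

lemma congruent_solids_refl: "congruent_solids H H"
  unfolding congruent_solids_def
  using orthogonal_transformation_id
  by (intro exI[of _ 0] exI[of _ "\<lambda>x. x"]) simp

text \<open>
  The reflection in the plane \<open>x = y\<close> preserves both horizontal planes and, in each of them,
  interchanges the two sides of the rectangle.
\<close>

lemma standard_hexahedron_swap:
  "congruent_solids (standard_hexahedron a b h) (standard_hexahedron b a h)"
proof -
  define R :: "real ^ 3 \<Rightarrow> real ^ 3" where "R x = vector [x $ 2, x $ 1, x $ 3]" for x
  have lin: "linear R"
    by (rule linearI) (simp_all add: R_def vec_eq_iff forall_3)
  have ortho: "orthogonal_transformation R"
    unfolding orthogonal_transformation_def using lin
    by (simp add: R_def inner_vec_def sum_3)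
  have R: "R (top_vertex a b h s t) = top_vertex b a h t s"
    "R (bottom_vertex a b s t) = bottom_vertex b a t s" for a b s t
    by (simp_all add: R_def top_vertex_def bottom_vertex_def)
  have signs: "{F s t | s t. s \<in> {-1, 1} \<and> t \<in> {-1, 1}} =
      {F (-1) (-1), F (-1) 1, F 1 (-1), F 1 1}" for F :: "real \<Rightarrow> real \<Rightarrow> real ^ 3"
    by blast
  have "R ` {top_vertex a b h s t | s t. s \<in> {-1, 1} \<and> t \<in> {-1, 1}} =
      {top_vertex b a h s t | s t. s \<in> {-1, 1} \<and> t \<in> {-1, 1}}"
    unfolding signs image_insert image_empty R by (simp only: insert_commute)
  moreover have "R ` {bottom_vertex a b s t | s t. s \<in> {-1, 1} \<and> t \<in> {-1, 1}} =
      {bottom_vertex b a s t | s t. s \<in> {-1, 1} \<and> t \<in> {-1, 1}}"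
    unfolding signs image_insert image_empty R by (simp only: insert_commute)
  ultimately have "standard_hexahedron b a h = (\<lambda>x. 0 + R x) ` standard_hexahedron a b h"
    unfolding standard_hexahedron_def
    by (simp add: convex_hull_linear_image[OF lin] image_Un)
  then show ?thesis
    using ortho unfolding congruent_solids_def by blast
qed

text \<open>
  The slant side determines the height, so \<open>a\<close>, \<open>b\<close>, \<open>e\<close> leave only the rigid motion free. The
  formula for the height is symmetric in \<open>a\<close> and \<open>b\<close>.
\<close>

lemma perfect_hexahedron_congruent_standard:
  assumes "perfect_hexahedron H a b c d e f"
  shows "congruent_solids
    (standard_hexahedron a b (sqrt ((real e)\<^sup>2 - (real a - real b)\<^sup>2 / 2))) H"
proof -
  obtain h where h: "h > 0" "congruent_solids (standard_hexahedron a b h) H"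
    and e: "dist (top_vertex a b h 1 1) (bottom_vertex a b 1 1) = e"
    using assms unfolding perfect_hexahedron_def by auto
  have "(real e)\<^sup>2 = (real a - real b)\<^sup>2 / 2 + h\<^sup>2"
    unfolding e[symmetric] top_vertex_def bottom_vertex_def dist_vector3_sq
    by (simp add: power2_eq_square field_simps)
  then have "sqrt ((real e)\<^sup>2 - (real a - real b)\<^sup>2 / 2) = h"
    using h(1) by simp
  with h(2) show ?thesis by simp
qed

text \<open>The equation \<open>7\<^sup>2 = (8 - 15)\<^sup>2 / 2 + h\<^sup>2\<close> for the slant side gives the height.\<close>

lemma perfect_hexahedron_8_15:
  "perfect_hexahedron (standard_hexahedron 8 15 (sqrt (49 / 2))) 8 15 17 13 7 17"
proof -
  have dist_eqI: "dist x y = r" if "(dist x y)\<^sup>2 = r\<^sup>2" "0 \<le> r" for x y :: "real ^ 3" and r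
    using that by (simp add: power2_eq_iff_nonneg)
  show ?thesis
    unfolding perfect_hexahedron_def
    by (intro conjI exI[of _ "sqrt (49 / 2)"] ballI dist_eqI)
      (auto simp: congruent_solids_refl top_vertex_def bottom_vertex_def dist_vector3_sq
        power_divide)
qed

section \<open>The two smallest sizes\<close>

theorem theorem1:
  shows
    "((hexahedron_solution 8 15 17 13 7 17 \<and> hexahedron_size 8 15 = 60) \<and>
      (\<exists>H. perfect_hexahedron H 8 15 17 13 7 17) \<and>
      (\<forall>a b c d e f. hexahedron_solution a b c d e f \<and> hexahedron_size a b = 60 \<longrightarrow>
         (a, b, c, d, e, f) \<in> {(8, 15, 17, 13, 7, 17), (15, 8, 17, 13, 7, 17)}) \<and>
      (\<forall>G H a b c d e f a' b' c' d' e' f'.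
         perfect_hexahedron G a b c d e f \<and> hexahedron_size a b = 60 \<and>
         perfect_hexahedron H a' b' c' d' e' f' \<and> hexahedron_size a' b' = 60 \<longrightarrow>
         congruent_solids G H) \<and>
      (\<forall>a b c d e f. hexahedron_solution a b c d e f \<longrightarrow> 60 \<le> hexahedron_size a b))
     \<and>
     ((hexahedron_solution 24 10 26 17 7 23 \<and> hexahedron_size 24 10 = 120) \<and>
      (\<forall>a b c d e f. hexahedron_solution a b c d e f \<and> hexahedron_size a b = 120 \<longrightarrow>
         (a, b, c, d, e, f) \<in> {(24, 10, 26, 17, 7, 23), (10, 24, 26, 17, 7, 23)}) \<and>
      (\<forall>a b c d e f. hexahedron_solution a b c d e f \<and> hexahedron_size a b \<noteq> 60 \<longrightarrow>
         120 \<le> hexahedron_size a b))"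
proof -
  have solution_8_15: "hexahedron_solution 8 15 17 13 7 17"
    by (simp add: hexahedron_solution_def)
  have size_le: "a * b \<le> 240" if "hexahedron_size a b \<le> 120" for a b
  proof -
    have "real (a * b) \<le> real 240" using that by (simp add: hexahedron_size_def)
    then show ?thesis by (simp only: of_nat_le_iff)
  qed
  note small = hexahedron_solution_le_240[OF _ size_le]
  have size60: "(a, b, c, d, e, f) \<in> {(8, 15, 17, 13, 7, 17), (15, 8, 17, 13, 7, 17)}"
    if "hexahedron_solution a b c d e f" "hexahedron_size a b = 60" for a b c d e f
    using small[OF that(1)] that(2) by (auto simp: hexahedron_size_def)
  have size120: "(a, b, c, d, e, f) \<in> {(24, 10, 26, 17, 7, 23), (10, 24, 26, 17, 7, 23)}"
    if "hexahedron_solution a b c d e f" "hexahedron_size a b = 120" for a b c d e f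
    using small[OF that(1)] that(2) by (auto simp: hexahedron_size_def)
  have least: "hexahedron_size a b = 60 \<or> 120 \<le> hexahedron_size a b"
    if "hexahedron_solution a b c d e f" for a b c d e f
    using small[OF that] by (cases "hexahedron_size a b \<le> 120") (auto simp: hexahedron_size_def)
  have unique: "congruent_solids G H"
    if "perfect_hexahedron G a b c d e f" "hexahedron_size a b = 60"
      "perfect_hexahedron H a' b' c' d' e' f'" "hexahedron_size a' b' = 60"
    for G H a b c d e f a' b' c' d' e' f'
  proof -
    have normal: "congruent_solids (standard_hexahedron 8 15 (sqrt (49 / 2))) K"
      if perfect: "perfect_hexahedron K a b c d e f" and size: "hexahedron_size a b = 60"
      for K a b c d e f
    proof -
      have K: "congruent_solids
          (standard_hexahedron a b (sqrt ((real e)\<^sup>2 - (real a - real b)\<^sup>2 / 2))) K"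
        using perfect_hexahedron_congruent_standard[OF perfect] .
      consider "a = 8" "b = 15" "e = 7" | "a = 15" "b = 8" "e = 7"
        using size60[OF perfect_hexahedron_imp_solution[OF perfect] size] by auto
      then show ?thesis
      proof cases
        case 1
        with K show ?thesis by simp
      next
        case 2
        with K have "congruent_solids (standard_hexahedron 15 8 (sqrt (49 / 2))) K" by simp
        with standard_hexahedron_swap show ?thesis by (rule congruent_solids_trans)
      qed
    qed
    show ?thesis
      using congruent_solids_trans[OF congruent_solids_sym[OF normal[OF that(1,2)]]
          normal[OF that(3,4)]] .
  qed
  have sizes: "hexahedron_size 8 15 = 60" "hexahedron_size 24 10 = 120"
    by (simp_all add: hexahedron_size_def)
  show ?thesis
  proof (intro conjI allI impI, goal_cases)
    case 1 show ?case by (rule solution_8_15)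
  next
    case 2 show ?case by (rule sizes)
  next
    case 3 show ?case using perfect_hexahedron_8_15 by (rule exI)
  next
    case 4 then show ?case by (elim conjE) (rule size60)
  next
    case 5 then show ?case by (elim conjE) (rule unique)
  next
    case (6 a b c d e f)
    from least[OF this] show ?case by auto
  next
    case 7 show ?case by (rule hexahedron_solution_24_10)
  next
    case 8 show ?case by (rule sizes)
  next
    case 9 then show ?case by (elim conjE) (rule size120)
  next
    case 10 then show ?case using least by blast
  qed
qed

end
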